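(* For all positive integers $\Delta$ and $m$ with $m \ge 2$, there is no $(\mathcal{M}_1, m, \lfloor \log_2 \Delta \rfloor + 1)$-stack in the set $\mathcal{M}_{\Delta}$.
   Context: For a positive integer $\Delta$, an integer matrix $\mathbf{A}$ is $\Delta$-modular if the determinant of each $\operatorname{rank}(\mathbf{A}) \times \operatorname{rank}(\mathbf{A})$ submatrix of $\mathbf{A}$ has absolute value at most $\Delta$. $\mathcal{M}_{\Delta}$ denotes the set of $\Delta$-modular matroids, i.e. the matroids that have a representation over $\mathbb{R}$ as a $\Delta$-modular (integer) matrix (the ground set indexes the columns, and the rank of a set of elements is the rank of the corresponding set of columns). In particular $\mathcal{M}_1$ is the set of regular matroids. For a matroid $M$ and sets $C, P$ of elements, $M/C$ denotes contraction and $M|P$ denotes restriction. For integers $m \ge 2$ and $h \ge 1$ and a collection $\mathcal{O}$ of matroids, a matroid $M$ is an $(\mathcal{O}, m, h)$-stack if there are disjoint sets $P_1, P_2, \dots, P_h \subseteq E(M)$ such that (i) $\bigcup_{i=1}^h P_i$ spans $M$, and (ii) for each $i \in \{1, \dots, h\}$, the matroid $(M/(P_1 \cup \cdots \cup P_{i-1}))|P_i$ has rank at most $m$ and is not in $\mathcal{O}$. *)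

theory Defs
  imports
    Complex_Main
    "HOL-Library.Disjoint_Sets"
    "Jordan_Normal_Form.DL_Rank"
    "Jordan_Normal_Form.DL_Submatrix"
begin

section \<open>Matroids\<close>

record 'a matroid =
  ground :: "'a set"
  indep :: "'a set \<Rightarrow> bool"

locale matroid =
  fixes M :: "'a matroid"
  assumes finite_ground: "finite (ground M)"
    and indep_subset_ground: "indep M X \<Longrightarrow> X \<subseteq> ground M"
    and indep_empty: "indep M {}"
    and indep_subset: "indep M X \<Longrightarrow> Y \<subseteq> X \<Longrightarrow> indep M Y"
    and indep_augment: "indep M X \<Longrightarrow> indep M Y \<Longrightarrow> card X < card Y
      \<Longrightarrow> \<exists>y\<in>Y - X. indep M (insert y X)"

definition matroid_rank :: "'a matroid \<Rightarrow> 'a set \<Rightarrow> nat" where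
  "matroid_rank M X = Max (card ` {I. I \<subseteq> X \<and> indep M I})"

definition matroid_closure :: "'a matroid \<Rightarrow> 'a set \<Rightarrow> 'a set" where
  "matroid_closure M X = {e \<in> ground M. matroid_rank M (insert e X) = matroid_rank M X}"

definition spans :: "'a matroid \<Rightarrow> 'a set \<Rightarrow> bool" where
  "spans M X \<longleftrightarrow> X \<subseteq> ground M \<and> matroid_closure M X = ground M"

definition restriction :: "'a matroid \<Rightarrow> 'a set \<Rightarrow> 'a matroid" where
  "restriction M P = \<lparr>ground = ground M \<inter> P, indep = (\<lambda>X. X \<subseteq> P \<and> indep M X)\<rparr>"

definition basis_of :: "'a matroid \<Rightarrow> 'a set \<Rightarrow> 'a set \<Rightarrow> bool" where
  "basis_of M C B \<longleftrightarrow> B \<subseteq> C \<and> indep M B \<and> (\<forall>B'. B \<subseteq> B' \<and> B' \<subseteq> C \<and> indep M B' \<longrightarrow> B' = B)"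

text \<open>A set is independent in \<open>M / C\<close> if its union with a basis of \<open>C\<close> is independent
  in \<open>M\<close>. The choice of the basis does not matter, see \<open>matroid.indep_contraction_any\<close>.\<close>

definition contraction :: "'a matroid \<Rightarrow> 'a set \<Rightarrow> 'a matroid" where
  "contraction M C = \<lparr>ground = ground M - C,
     indep = (\<lambda>X. X \<subseteq> ground M - C \<and> (\<exists>B. basis_of M C B \<and> indep M (X \<union> B)))\<rparr>"

context matroid
begin

lemma indep_finite: "indep M X \<Longrightarrow> finite X"
  using finite_ground indep_subset_ground finite_subset by blast

lemma indep_extend:
  assumes "indep M I" "indep M J" "card I \<le> card J"
  shows "\<exists>K. I \<subseteq> K \<and> K \<subseteq> I \<union> J \<and> indep M K \<and> card K = card J"
  using assms
proof (induction "card J - card I" arbitrary: I)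
  case 0
  then show ?case by (intro exI[of _ I]) auto
next
  case (Suc n)
  then have "card I < card J" by linarith
  then obtain y where y: "y \<in> J - I" "indep M (insert y I)"
    using indep_augment Suc.prems by blast
  have c: "card (insert y I) = Suc (card I)"
    using y indep_finite[OF Suc.prems(1)] by simp
  have "\<exists>K. insert y I \<subseteq> K \<and> K \<subseteq> insert y I \<union> J \<and> indep M K \<and> card K = card J"
    by (rule Suc.hyps(1)) (use c y Suc \<open>card I < card J\<close> in auto)
  then show ?case using y by blast
qed

lemma basis_of_exists: "\<exists>B. basis_of M C B"
proof -
  let ?S = "{I. I \<subseteq> C \<and> indep M I}"
  have "finite ?S"
    by (rule finite_subset[of _ "Pow (ground M)"])
      (use finite_ground indep_subset_ground in auto)
  moreover have "{} \<in> ?S" using indep_empty by simp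
  ultimately obtain B where "B \<in> ?S" "\<forall>B'\<in>?S. B \<subseteq> B' \<longrightarrow> B = B'"
    using finite_has_maximal[of ?S] by blast
  then have "basis_of M C B" unfolding basis_of_def by blast
  then show ?thesis ..
qed

lemma basis_of_card_le:
  assumes "basis_of M C B" "I \<subseteq> C" "indep M I"
  shows "card I \<le> card B"
proof (rule ccontr)
  assume "\<not> ?thesis"
  then obtain y where y: "y \<in> I - B" "indep M (insert y B)"
    using indep_augment[of B I] assms unfolding basis_of_def by auto
  then have "insert y B = B" using assms unfolding basis_of_def by blast
  then show False using y by blast
qed

lemma indep_contraction_any:
  assumes "X \<subseteq> ground M - C" "basis_of M C B"
  shows "indep (contraction M C) X \<longleftrightarrow> indep M (X \<union> B)"
proof
  assume "indep M (X \<union> B)"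
  then show "indep (contraction M C) X" using assms by (auto simp: contraction_def)
next
  assume "indep (contraction M C) X"
  then obtain D where D: "basis_of M C D" "indep M (X \<union> D)"
    by (auto simp: contraction_def)
  have B: "B \<subseteq> C" "indep M B" "D \<subseteq> C" "indep M D"
    using assms D unfolding basis_of_def by auto
  have fin: "finite X" "finite B" "finite D"
    using D(2) B indep_finite by (auto dest: indep_finite)
  have cBD: "card B = card D"
    using basis_of_card_le[OF assms(2) B(3,4)] basis_of_card_le[OF D(1) B(1,2)] by simp
  have cX: "card (X \<union> D) = card X + card D" "card (X \<union> B) = card X + card B"
    using assms(1) B fin by (auto intro!: card_Un_disjoint)
  obtain K where K: "B \<subseteq> K" "K \<subseteq> B \<union> (X \<union> D)" "indep M K" "card K = card (X \<union> D)"
    using indep_extend[OF B(2) D(2)] cX cBD by auto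
  have "indep M (K \<inter> C)" using K indep_subset by blast
  moreover have "B \<subseteq> K \<inter> C" using K B by blast
  ultimately have "K \<inter> C = B" using assms(2) unfolding basis_of_def by blast
  then have "K \<subseteq> X \<union> B" using K B by blast
  then have "K = X \<union> B"
    by (rule card_subset_eq[rotated]) (use fin cX cBD K in auto)
  then show "indep M (X \<union> B)" using K by simp
qed

lemma matroid_restriction: "matroid (restriction M P)"
proof
  fix X Y
  assume "indep (restriction M P) X" "indep (restriction M P) Y" "card X < card Y"
  then show "\<exists>y\<in>Y - X. indep (restriction M P) (insert y X)"
    using indep_augment[of X Y] by (auto simp: restriction_def)
qed (use finite_ground indep_subset_ground indep_empty indep_subset in
      \<open>auto simp: restriction_def\<close>)

lemma matroid_contraction: "matroid (contraction M C)"
proof -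
  obtain B where B: "basis_of M C B" using basis_of_exists by blast
  then have B': "B \<subseteq> C" "indep M B" unfolding basis_of_def by auto
  have ind: "indep (contraction M C) X \<longleftrightarrow> X \<subseteq> ground M - C \<and> indep M (X \<union> B)" for X
    using indep_contraction_any[OF _ B, of X] by (auto simp: contraction_def)
  show ?thesis
  proof
    show "finite (ground (contraction M C))"
      using finite_ground by (simp add: contraction_def)
    show "indep (contraction M C) {}" using B' ind by simp
    show "indep (contraction M C) Y" if "indep (contraction M C) X" "Y \<subseteq> X" for X Y
    proof -
      have "indep M (Y \<union> B)"
        by (rule indep_subset[of "X \<union> B"]) (use that ind in auto)
      then show ?thesis using that ind by blast
    qed
    show "X \<subseteq> ground (contraction M C)" if "indep (contraction M C) X" for X
      using that by (auto simp: contraction_def)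
    fix X Y
    assume XY: "indep (contraction M C) X" "indep (contraction M C) Y" "card X < card Y"
    then have i: "indep M (X \<union> B)" "indep M (Y \<union> B)" "X \<inter> B = {}" "Y \<inter> B = {}"
      using ind B' by blast+
    then have "finite X" "finite Y" "finite B" by (auto dest: indep_finite)
    then have "card (X \<union> B) < card (Y \<union> B)"
      using XY(3) i by (simp add: card_Un_disjoint)
    then obtain y where y: "y \<in> (Y \<union> B) - (X \<union> B)" "indep M (insert y (X \<union> B))"
      using indep_augment i by blast
    then have "indep (contraction M C) (insert y X)" using XY ind by auto
    then show "\<exists>y\<in>Y - X. indep (contraction M C) (insert y X)" using y by blast
  qed
qed

end

section \<open>Modular matrices and the matroids they represent\<close>

definition real_rank :: "int mat \<Rightarrow> nat" where
  "real_rank A = vec_space.rank (dim_row A) (map_mat real_of_int A)"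

definition modular_matrix :: "nat \<Rightarrow> int mat \<Rightarrow> bool" where
  "modular_matrix \<Delta> A \<longleftrightarrow>
     (\<forall>I J. I \<subseteq> {..<dim_row A} \<and> J \<subseteq> {..<dim_col A} \<and>
            card I = real_rank A \<and> card J = real_rank A
        \<longrightarrow> \<bar>det (submatrix A I J)\<bar> \<le> int \<Delta>)"

text \<open>The bijection \<open>c\<close> labels the columns of \<open>A\<close> by elements of the ground set, so parallel
  elements may have equal columns.\<close>

definition represents :: "int mat \<Rightarrow> 'a matroid \<Rightarrow> bool" where
  "represents A M \<longleftrightarrow>
     (\<exists>c. bij_betw c (ground M) {..<dim_col A} \<and>
          (\<forall>X \<subseteq> ground M. matroid_rank M X = real_rank (submatrix A UNIV (c ` X))))"

definition modular_matroids :: "nat \<Rightarrow> 'a matroid set" where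
  "modular_matroids \<Delta> = {M. matroid M \<and> (\<exists>A. modular_matrix \<Delta> A \<and> represents A M)}"

section \<open>Stacks\<close>

definition is_stack :: "'a matroid set \<Rightarrow> nat \<Rightarrow> nat \<Rightarrow> 'a matroid \<Rightarrow> bool" where
  "is_stack \<O> m h M \<longleftrightarrow> matroid M \<and>
     (\<exists>P :: nat \<Rightarrow> 'a set.
        (\<forall>i\<in>{1..h}. P i \<subseteq> ground M) \<and>
        disjoint_family_on P {1..h} \<and>
        spans M (\<Union>i\<in>{1..h}. P i) \<and>
        (\<forall>i\<in>{1..h}.
           let N = restriction (contraction M (\<Union>j\<in>{1..<i}. P j)) (P i)
           in matroid_rank N (ground N) \<le> m \<and> N \<notin> \<O>))"

end

theory Submission
  imports Defs
begin

text \<open>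
  The proof produces a maximal minor of absolute value at least \<open>2 ^ h\<close> in every integer matrix with
  independent rows that represents a matroid with a stack of height \<open>h\<close>, the layers of the stack
  being non-regular. For \<open>h = \<lfloor>log 2 \<Delta>\<rfloor> + 1\<close> this number exceeds \<open>\<Delta>\<close>.

  The minor is built one layer at a time. Let \<open>P\<close> be the first layer. Integer row operations of
  determinant one turn the columns in \<open>P\<close> into a block \<open>B\<close> with independent rows above a block of
  zeros (\<open>row_reduction\<close>), so that the whole matrix has the shape
  \<open>(B * | 0 C)\<close>. Here \<open>B\<close> represents \<open>M | P\<close>, and \<open>C\<close> represents \<open>M / P\<close>
  (\<open>indep_cols_contraction\<close>). As \<open>M | P\<close> is not regular, the integer matrix \<open>B\<close> has a maximal minor of
  absolute value at least two (\<open>non_modular_large_det\<close>). The other layers form a stack of height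
  \<open>h - 1\<close> in \<open>M / P\<close>, which by induction gives a maximal minor of \<open>C\<close> of absolute value at least
  \<open>2 ^ (h - 1)\<close>. The columns of both minors together form a block triangular maximal minor of the
  whole matrix, whose value is the product of the two (\<open>stack_large_det\<close>). It is essential that the row
  operations are unimodular: they keep all maximal minors, and they keep \<open>B\<close> and \<open>C\<close> integral,
  so that the definition of a regular matroid applies to \<open>B\<close>.

  Matrices are handled as functions \<open>a i x\<close> of a row number \<open>i\<close> and a column label \<open>x\<close>, where the labels
  are the elements of the matroid. Deleting columns, or passing to the lower rows, then
  needs no renumbering of the columns.
\<close>

section \<open>Integer matrices with labelled columns\<close>

definition colmat :: "nat \<Rightarrow> (nat \<Rightarrow> 'b \<Rightarrow> int) \<Rightarrow> 'b list \<Rightarrow> int mat" where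
  "colmat n a xs = mat n (length xs) (\<lambda>(i, j). a i (xs ! j))"

text \<open>Independence of the family of columns labelled by \<open>X\<close>: equal columns with different labels are
  dependent, as parallel elements of a matroid should be.\<close>

definition indep_cols :: "nat \<Rightarrow> (nat \<Rightarrow> 'b \<Rightarrow> int) \<Rightarrow> 'b set \<Rightarrow> bool" where
  "indep_cols n a X \<longleftrightarrow>
     (\<forall>v :: 'b \<Rightarrow> real. (\<forall>i<n. (\<Sum>x\<in>X. v x * a i x) = 0) \<longrightarrow> (\<forall>x\<in>X. v x = 0))"

text \<open>For integer entries, independence over the integers and over the reals coincide. Integer
  coefficients are what the Euclidean algorithm on the rows can work on.\<close>

definition indep_rows :: "nat set \<Rightarrow> (nat \<Rightarrow> 'b \<Rightarrow> int) \<Rightarrow> 'b set \<Rightarrow> bool" where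
  "indep_rows I a P \<longleftrightarrow>
     (\<forall>w :: nat \<Rightarrow> int. (\<forall>x\<in>P. (\<Sum>i\<in>I. w i * a i x) = 0) \<longrightarrow> (\<forall>i\<in>I. w i = 0))"

lemma colmat_carrier [simp]: "length xs = k \<Longrightarrow> colmat n a xs \<in> carrier_mat n k"
  by (simp add: colmat_def)

lemma dim_colmat [simp]: "dim_row (colmat n a xs) = n" "dim_col (colmat n a xs) = length xs"
  by (simp_all add: colmat_def)

lemma sum_set_nth: "distinct xs \<Longrightarrow> (\<Sum>x\<in>set xs. f x) = (\<Sum>j<length xs. f (xs ! j))"
  by (rule sum.reindex_bij_betw[OF bij_betw_nth, symmetric]) auto

lemma indep_colsD:
  assumes "indep_cols n a X" "\<And>i. i < n \<Longrightarrow> (\<Sum>x\<in>X. v x * real_of_int (a i x)) = 0" "x \<in> X"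
  shows "v x = 0"
  using assms unfolding indep_cols_def by blast

lemma indep_rowsD:
  assumes "indep_rows I a P" "\<And>x. x \<in> P \<Longrightarrow> (\<Sum>i\<in>I. w i * a i x) = 0" "i \<in> I"
  shows "w i = 0"
  using assms unfolding indep_rows_def by blast

lemma obtain_coeffs_on_list:
  assumes "distinct xs"
  obtains u where "\<And>j. j < length xs \<Longrightarrow> u (xs ! j) = g j"
proof
  show "(\<lambda>x. g (the_inv_into {..<length xs} ((!) xs) x)) (xs ! j) = g j" if "j < length xs" for j
    using that assms by (simp add: the_inv_into_f_f inj_on_nth)
qed

text \<open>The rank is the dimension of the span of the set of columns, which forgets the labels. Choosing
  one label for each vector of a maximal independent set of columns gives the equality; an
  independent set of labels has pairwise distinct columns, hence loses nothing.\<close>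

lemma real_rank_colmat:
  assumes "distinct xs"
  shows "real_rank (colmat n a xs) = Max (card ` {K. K \<subseteq> set xs \<and> indep_cols n a K})"
proof -
  interpret V: vec_space "TYPE(real)" n .
  define R where "R ys = map_mat real_of_int (colmat n a ys)" for ys
  define w where "w x = vec n (\<lambda>i. real_of_int (a i x))" for x
  have R: "R ys \<in> carrier_mat n (length ys)" for ys
    by (simp add: R_def)
  have cols: "cols (R ys) = map w ys" for ys
    by (rule nth_equalityI) (auto simp: R_def w_def colmat_def cols_def col_def)
  have mult: "R ys *\<^sub>v v = 0\<^sub>v n \<longleftrightarrow> (\<forall>i<n. (\<Sum>j<length ys. v $ j * a i (ys ! j)) = 0)"
    if "v \<in> carrier_vec (length ys)" for ys v
    using that by (auto simp: vec_eq_iff R_def colmat_def scalar_prod_def mult.commute lessThan_atLeast0)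
  have key: "indep_cols n a (set ys) \<longleftrightarrow> distinct (map w ys) \<and> V.lin_indpt (set (map w ys))"
    if d: "distinct ys" for ys
  proof
    assume ind: "indep_cols n a (set ys)"
    have "inj_on w (set ys)"
    proof (rule inj_onI, rule ccontr)
      fix x y assume xy: "x \<in> set ys" "y \<in> set ys" "w x = w y" "x \<noteq> y"
      define v :: "'a \<Rightarrow> real" where "v z = (if z = x then 1 else if z = y then - 1 else 0)" for z
      have "(\<Sum>z\<in>set ys. v z * a i z) = 0" if "i < n" for i
      proof -
        have "(\<Sum>z\<in>set ys. v z * a i z) = (\<Sum>z\<in>{x, y}. v z * a i z)"
          by (rule sum.mono_neutral_right) (use xy in \<open>auto simp: v_def\<close>)
        also have "\<dots> = w x $ i - w y $ i"
          using xy(4) that by (simp add: v_def w_def)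
        finally show ?thesis using xy(3) by simp
      qed
      from indep_colsD[OF ind this xy(1)] show False by (simp add: v_def)
    qed
    with d have dw: "distinct (map w ys)" by (simp add: distinct_map)
    moreover have "V.lin_indpt (set (map w ys))"
    proof
      assume "V.lin_dep (set (map w ys))"
      with V.lin_depE[OF R, of ys] dw cols
      obtain v where v: "v \<in> carrier_vec (length ys)" "v \<noteq> 0\<^sub>v (length ys)" "R ys *\<^sub>v v = 0\<^sub>v n"
        by metis
      obtain u where u: "\<And>j. j < length ys \<Longrightarrow> u (ys ! j) = v $ j"
        using obtain_coeffs_on_list[OF d] by blast
      have "(\<Sum>x\<in>set ys. u x * a i x) = 0" if "i < n" for i
        using v(3) that unfolding mult[OF v(1)] by (simp add: sum_set_nth[OF d] u)
      from indep_colsD[OF ind this] have "v $ j = 0" if "j < length ys" for j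
        using that u by (metis nth_mem)
      with v(1,2) show False by auto
    qed
    ultimately show "distinct (map w ys) \<and> V.lin_indpt (set (map w ys))" by blast
  next
    assume asm: "distinct (map w ys) \<and> V.lin_indpt (set (map w ys))"
    show "indep_cols n a (set ys)"
      unfolding indep_cols_def
    proof (intro allI impI ballI, rule ccontr)
      fix v :: "'a \<Rightarrow> real" and x
      assume v: "\<forall>i<n. (\<Sum>x\<in>set ys. v x * a i x) = 0" and x: "x \<in> set ys" "v x \<noteq> 0"
      define u where "u = vec (length ys) (\<lambda>j. v (ys ! j))"
      from x obtain j where "j < length ys" "v (ys ! j) \<noteq> 0" by (auto simp: in_set_conv_nth)
      then have "u \<noteq> 0\<^sub>v (length ys)" by (auto simp: u_def vec_eq_iff)
      moreover have "R ys *\<^sub>v u = 0\<^sub>v n"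
        by (subst mult) (use v in \<open>auto simp: u_def sum_set_nth[OF d]\<close>)
      ultimately have "V.lin_dep (set (cols (R ys)))"
        by (intro V.lin_depI[OF R, of u]) (use asm cols in \<open>auto simp: u_def\<close>)
      with asm cols show False by simp
    qed
  qed
  have fin: "finite {K. K \<subseteq> set xs \<and> indep_cols n a K}" by simp
  have "real_rank (colmat n a xs) \<in> card ` {K. K \<subseteq> set xs \<and> indep_cols n a K}"
  proof -
    have "V.lin_indpt {}"
      using key[of "[]"] by (simp add: indep_cols_def)
    then obtain S where S: "maximal S (\<lambda>T. T \<subseteq> set (cols (R xs)) \<and> V.lin_indpt T)"
      using maximal_exists_superset[of "set (cols (R xs))"
          "\<lambda>T. T \<subseteq> set (cols (R xs)) \<and> V.lin_indpt T" "{}"] by auto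
    then have S': "S \<subseteq> w ` set xs" "V.lin_indpt S"
      unfolding maximal_def by (auto simp: cols)
    then obtain K where K: "K \<subseteq> set xs" "inj_on w K" "S = w ` K"
      by (meson subset_image_inj)
    obtain ys where ys: "distinct ys" "set ys = K"
      using finite_distinct_list[OF finite_subset[OF K(1) finite_set]] by blast
    have "indep_cols n a K"
      using key[OF ys(1)] ys K S' by (simp add: distinct_map)
    moreover have "real_rank (colmat n a xs) = card K"
      using V.rank_card_indpt[OF R S] card_image[OF K(2)] K(3)
      by (simp add: real_rank_def R_def)
    ultimately show ?thesis using K(1) by blast
  qed
  moreover have "card K \<le> real_rank (colmat n a xs)" if K: "K \<subseteq> set xs" "indep_cols n a K" for K
  proof -
    obtain ys where ys: "distinct ys" "set ys = K"
      using finite_distinct_list[OF finite_subset[OF K(1) finite_set]] by blast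
    have *: "inj_on w K" "V.lin_indpt (w ` K)"
      using key[OF ys(1)] K(2) unfolding ys(2) by (simp_all add: distinct_map ys(2))
    have "card (w ` K) \<le> V.rank (R xs)"
      by (rule V.rank_ge_card_indpt[OF R]) (use K(1) * in \<open>auto simp: cols\<close>)
    then show ?thesis using card_image[OF *(1)] by (simp add: real_rank_def R_def)
  qed
  ultimately show ?thesis
    using fin by (intro Max_eqI[symmetric] finite_imageI) blast+
qed

text \<open>Row rank equals column rank, in terms of minors. A nonzero minor on the first \<open>n\<close> rows can be
  extended by some column: expanding the larger determinant along its last column gives a
  combination of the rows in which the last coefficient is the smaller minor, so it cannot vanish
  on all of \<open>P\<close>.\<close>

lemma indep_rows_imp_nonzero_det:
  assumes "indep_rows {..<n} a P"
  shows "\<exists>xs. set xs \<subseteq> P \<and> length xs = n \<and> det (colmat n a xs) \<noteq> 0"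
  using assms
proof (induction n)
  case 0
  then show ?case by (intro exI[of _ "[]"]) (simp add: colmat_def)
next
  case (Suc n)
  have "indep_rows {..<n} a P"
    unfolding indep_rows_def
  proof (intro allI impI)
    fix w :: "nat \<Rightarrow> int" assume w: "\<forall>x\<in>P. (\<Sum>i<n. w i * a i x) = 0"
    have "(\<Sum>i<Suc n. (if i < n then w i else 0) * a i x) = 0" if "x \<in> P" for x
      using w that by simp
    from indep_rowsD[OF Suc.prems this]
    have "(if i < n then w i else 0) = 0" if "i < Suc n" for i using that by simp
    then show "\<forall>i\<in>{..<n}. w i = 0" by (metis lessThan_iff less_SucI)
  qed
  with Suc.IH obtain xs where xs: "set xs \<subseteq> P" "length xs = n" "det (colmat n a xs) \<noteq> 0"
    by blast
  \<comment> \<open>The cofactors along the last column do not depend on that column.\<close>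
  define C where "C x = colmat (Suc n) a (xs @ [x])" for x
  define w where "w i = cofactor (C undefined) i n" for i
  have del: "mat_delete (C x) i n = mat_delete (C y) i n" if "i \<le> n" for x y i
    using that xs(2) by (intro eq_matI) (auto simp: C_def colmat_def mat_delete_def nth_append)
  have expand: "det (C x) = (\<Sum>i<Suc n. w i * a i x)" for x
  proof -
    have "det (C x) = (\<Sum>i<Suc n. C x $$ (i, n) * cofactor (C x) i n)"
      by (rule laplace_expansion_column) (use xs(2) in \<open>auto simp: C_def\<close>)
    also have "\<dots> = (\<Sum>i<Suc n. w i * a i x)"
      by (rule sum.cong)
        (use xs(2) in \<open>auto simp: w_def cofactor_def del[of _ x undefined] less_Suc_eq_le\<close>,
         auto simp: C_def colmat_def nth_append)
    finally show ?thesis .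
  qed
  have "mat_delete (C undefined) n n = colmat n a xs"
    using xs(2) by (intro eq_matI) (auto simp: C_def colmat_def mat_delete_def nth_append)
  with xs(3) have "w n \<noteq> 0" by (simp add: w_def cofactor_def)
  then obtain x where "x \<in> P" "det (C x) \<noteq> 0"
    using Suc.prems unfolding indep_rows_def expand by blast
  with xs show ?case by (intro exI[of _ "xs @ [x]"]) (auto simp: C_def)
qed

lemma nonzero_det_distinct:
  assumes "length xs = n" "det (colmat n a xs) \<noteq> 0"
  shows "distinct xs"
proof (rule ccontr)
  assume "\<not> distinct xs"
  then obtain i j where ij: "i < n" "j < n" "i \<noteq> j" "xs ! i = xs ! j"
    using assms(1) by (auto simp: distinct_conv_nth)
  have "det (colmat n a xs) = 0"
    by (rule det_identical_cols[OF _ ij(3,1,2)])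
      (use ij assms(1) in \<open>auto simp: colmat_def col_def\<close>)
  with assms(2) show False by simp
qed

lemma nonzero_det_indep_cols:
  assumes "length xs = n" "det (colmat n a xs) \<noteq> 0"
  shows "indep_cols n a (set xs)"
  unfolding indep_cols_def
proof (intro allI impI ballI, rule ccontr)
  note d = nonzero_det_distinct[OF assms]
  fix v :: "'a \<Rightarrow> real" and x
  assume v: "\<forall>i<n. (\<Sum>x\<in>set xs. v x * a i x) = 0" and x: "x \<in> set xs" "v x \<noteq> 0"
  let ?R = "map_mat real_of_int (colmat n a xs)"
  have R: "?R \<in> carrier_mat n n" using assms(1) by simp
  define u where "u = vec n (\<lambda>j. v (xs ! j))"
  from x obtain j where "j < n" "v (xs ! j) \<noteq> 0" using assms(1) by (auto simp: in_set_conv_nth)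
  then have "u \<noteq> 0\<^sub>v n" by (auto simp: u_def vec_eq_iff)
  moreover have "?R *\<^sub>v u = 0\<^sub>v n"
    using v assms(1)
    by (auto simp: u_def sum_set_nth[OF d] vec_eq_iff colmat_def scalar_prod_def mult.commute
        lessThan_atLeast0)
  ultimately have "det ?R = 0"
    using det_0_iff_vec_prod_zero_field[OF R] vec_carrier[of n] unfolding u_def by blast
  with assms(2) show False by simp
qed

lemma nonzero_det_solve:
  assumes "length xs = n" "det (colmat n a xs) \<noteq> 0"
  obtains u where "\<And>i. i < n \<Longrightarrow> (\<Sum>x\<in>set xs. u x * real_of_int (a i x)) = t i"
proof -
  note d = nonzero_det_distinct[OF assms]
  let ?R = "map_mat real_of_int (colmat n a xs)"
  have R: "?R \<in> carrier_mat n n" using assms(1) by simp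
  have "?R \<in> Units (ring_mat TYPE(real) n ())"
    by (rule det_non_zero_imp_unit[OF R]) (use assms(2) in simp)
  then obtain B where B: "B \<in> carrier_mat n n" "?R * B = 1\<^sub>m n"
    unfolding Units_def ring_mat_def by auto
  define v where "v = B *\<^sub>v vec n t"
  have v: "v \<in> carrier_vec n" using B(1) by (simp add: v_def)
  have "?R *\<^sub>v v = vec n t"
    unfolding v_def using assoc_mult_mat_vec[OF R B(1), of "vec n t"] B(2) by simp
  then have *: "(?R *\<^sub>v v) $ i = t i" if "i < n" for i using that by simp
  obtain u where u: "\<And>j. j < length xs \<Longrightarrow> u (xs ! j) = v $ j"
    using obtain_coeffs_on_list[OF d] by blast
  show ?thesis
  proof
    fix i assume i: "i < n"
    show "(\<Sum>x\<in>set xs. u x * real_of_int (a i x)) = t i"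
      using *[OF i] i v assms(1)
      by (simp add: sum_set_nth[OF d] u colmat_def scalar_prod_def mult.commute lessThan_atLeast0)
  qed
qed

lemma abs_det_colmat_perm:
  assumes "distinct xs" "distinct ys" "set xs = set ys" "length xs = n"
  shows "\<bar>det (colmat n a xs)\<bar> = \<bar>det (colmat n a ys)\<bar>"
proof -
  have "mset xs = mset ys" using assms(1-3) by (simp add: set_eq_iff_mset_eq_distinct)
  then obtain p where p: "p permutes {..<length ys}" "permute_list p ys = xs"
    by (rule mset_eq_permutation)
  have len: "length ys = n" using assms by (metis distinct_card)
  have pn: "p permutes {0..<n}" using p(1) len by (simp add: lessThan_atLeast0)
  let ?T = "transpose_mat (colmat n a ys)"
  have p_less: "p j < n" if "j < n" for j
    using permutes_in_image[OF p(1), of j] len that by simp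
  have nth: "xs ! j = ys ! p j" if "j < n" for j
    using permute_list_nth[OF p(1), of j] p(2) len that by simp
  have "transpose_mat (colmat n a xs) = mat n n (\<lambda>(i, j). ?T $$ (p i, j))"
    by (rule eq_matI) (simp_all add: colmat_def nth p_less len assms(4))
  moreover have "det (mat n n (\<lambda>(i, j). ?T $$ (p i, j))) = signof p * det ?T"
    by (rule det_permute_rows[OF _ pn]) (simp add: len)
  ultimately have "det (colmat n a xs) = signof p * det (colmat n a ys)"
    using det_transpose[of "colmat n a xs" n] det_transpose[of "colmat n a ys" n]
    by (simp add: len assms(4))
  then show ?thesis by (simp add: abs_mult sign_def)
qed

section \<open>Unimodular row reduction\<close>

text \<open>Adding a multiple of one row to another suffices; an exchange of rows up to sign is a composition
  of such steps. All of them have determinant one.\<close>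

inductive row_equiv :: "nat \<Rightarrow> (nat \<Rightarrow> 'b \<Rightarrow> int) \<Rightarrow> (nat \<Rightarrow> 'b \<Rightarrow> int) \<Rightarrow> bool"
  for n a where
  row_refl: "row_equiv n a a"
| add_row: "row_equiv n a b \<Longrightarrow> i < n \<Longrightarrow> j < n \<Longrightarrow> i \<noteq> j \<Longrightarrow>
    row_equiv n a (b(i := (\<lambda>x. b i x + c * b j x)))"

lemma row_equiv_trans: "row_equiv n b c \<Longrightarrow> row_equiv n a b \<Longrightarrow> row_equiv n a c"
  by (induction rule: row_equiv.induct) (auto intro: row_equiv.intros)

lemma row_equiv_mono: "row_equiv m a b \<Longrightarrow> m \<le> n \<Longrightarrow> row_equiv n a b"
  by (induction rule: row_equiv.induct) (auto intro: row_equiv.intros)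

lemma row_equiv_row_eq: "row_equiv m a b \<Longrightarrow> m \<le> i \<Longrightarrow> b i = a i"
  by (induction rule: row_equiv.induct) auto

lemma row_equiv_indep_cols:
  "row_equiv n a b \<Longrightarrow> indep_cols n b X \<longleftrightarrow> indep_cols n a X"
proof (induction rule: row_equiv.induct)
  case (add_row b i j c)
  let ?b = "b(i := (\<lambda>x. b i x + c * b j x))"
  have "(\<forall>k<n. (\<Sum>x\<in>X. v x * ?b k x) = 0) \<longleftrightarrow> (\<forall>k<n. (\<Sum>x\<in>X. v x * b k x) = 0)"
    for v :: "'a \<Rightarrow> real"
  proof -
    define S where "S k = (\<Sum>x\<in>X. v x * b k x)" for k
    have "(\<Sum>x\<in>X. v x * ?b k x) = S k + (if k = i then c * S j else 0)" for k
      by (simp add: S_def algebra_simps sum.distrib sum_distrib_left)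
    moreover have "(\<forall>k<n. S k + (if k = i then c * S j else 0) = 0) \<longleftrightarrow> (\<forall>k<n. S k = 0)"
      (is "?L = ?R")
    proof
      assume L: ?L
      then have "S j = 0" using add_row.hyps(3,4) by force
      then have "S k = 0" if "k < n" for k
        using L[rule_format, OF that] by (cases "k = i") simp_all
      then show ?R by blast
    qed (use add_row.hyps(3) in simp)
    ultimately show ?thesis by (simp only: S_def)
  qed
  with add_row.IH show ?case unfolding indep_cols_def by simp
qed simp

lemma row_equiv_indep_rows:
  "row_equiv n a b \<Longrightarrow> indep_rows {..<n} a P \<Longrightarrow> indep_rows {..<n} b P"
proof (induction rule: row_equiv.induct)
  case (add_row b i j c)
  let ?b = "b(i := (\<lambda>x. b i x + c * b j x))"
  show ?case unfolding indep_rows_def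
  proof (intro allI impI)
    fix w :: "nat \<Rightarrow> int" assume w: "\<forall>x\<in>P. (\<Sum>k<n. w k * ?b k x) = 0"
    define w' where "w' = w(j := w j + c * w i)"
    have "(\<Sum>k<n. w' k * b k x) = 0" if "x \<in> P" for x
    proof -
      have "(\<Sum>k<n. w' k * b k x) = (\<Sum>k<n. w k * b k x + (if k = j then c * w i * b j x else 0))"
        by (rule sum.cong) (auto simp: w'_def algebra_simps)
      also have "\<dots> = (\<Sum>k<n. w k * b k x + (if k = i then c * w i * b j x else 0))"
        using add_row.hyps by (simp add: sum.distrib)
      also have "\<dots> = (\<Sum>k<n. w k * ?b k x)"
        by (rule sum.cong) (auto simp: algebra_simps)
      finally show ?thesis using w that by simp
    qed
    from indep_rowsD[OF add_row.IH[OF add_row.prems] this]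
    have w': "w' k = 0" if "k < n" for k using that by simp
    have "w i = 0" using w'[OF add_row.hyps(2)] add_row.hyps(4) by (simp add: w'_def)
    then have "w' = w" by (auto simp: w'_def)
    then show "\<forall>k\<in>{..<n}. w k = 0" using w' by simp
  qed
qed simp

lemma row_equiv_det:
  "row_equiv n a b \<Longrightarrow> length xs = n \<Longrightarrow> det (colmat n b xs) = det (colmat n a xs)"
proof (induction rule: row_equiv.induct)
  case (add_row b i j c)
  have "colmat n (b(i := (\<lambda>x. b i x + c * b j x))) xs = addrow c i j (colmat n b xs)"
    using add_row.hyps by (intro eq_matI) (auto simp: colmat_def)
  then show ?case
    using det_addrow[OF add_row.hyps(3,4), of "colmat n b xs" c] add_row
    by (simp del: fun_upd_apply)
qed simp

text \<open>The Euclidean algorithm on the coefficients \<open>y\<close> of a relation between the rows. Subtracting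
  \<open>\<plusminus> y q\<close> from \<open>y p\<close> is compensated by adding \<open>\<plusminus>\<close> row \<open>p\<close> to row \<open>q\<close>, and decreases the sum of the
  absolute values. When only one coefficient is left, its row vanishes.\<close>

lemma row_relation_imp_zero_row:
  assumes "\<forall>x\<in>P. (\<Sum>k<n. y k * a k x) = 0" "i < n" "y i \<noteq> 0"
  shows "\<exists>b i. row_equiv n a b \<and> i < n \<and> (\<forall>x\<in>P. b i x = 0)"
  using assms
proof (induction "nat (\<Sum>k<n. \<bar>y k\<bar>)" arbitrary: a y i rule: less_induct)
  case less
  show ?case
  proof (cases "\<exists>j<n. j \<noteq> i \<and> y j \<noteq> 0")
    case False
    have "y i * a i x = 0" if "x \<in> P" for x
    proof -
      have "(\<Sum>k<n. y k * a k x) = (\<Sum>k\<in>{i}. y k * a k x)"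
        by (rule sum.mono_neutral_right) (use False less.prems(2) in auto)
      then show ?thesis using less.prems(1) that by simp
    qed
    then show ?thesis using less.prems(2,3) row_equiv.row_refl by fastforce
  next
    case True
    then obtain p q where pq: "p < n" "q < n" "p \<noteq> q" "y q \<noteq> 0" "\<bar>y q\<bar> \<le> \<bar>y p\<bar>"
      using less.prems(2,3) by (metis nle_le)
    \<comment> \<open>The sign makes \<open>y p - c * y q\<close> smaller than \<open>y p\<close> in absolute value.\<close>
    define c where "c = sgn (y p) * sgn (y q)"
    define z where "z = y(p := y p - c * y q)"
    define b where "b = a(q := (\<lambda>x. a q x + c * a p x))"
    have b: "row_equiv n a b"
      unfolding b_def by (intro row_equiv.intros) (use pq in auto)
    have "\<bar>z p\<bar> < \<bar>y p\<bar>"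
      using pq(4,5) by (auto simp: z_def c_def sgn_if)
    moreover have "(\<Sum>k<n. \<bar>z k\<bar>) = \<bar>z p\<bar> + (\<Sum>k\<in>{..<n} - {p}. \<bar>y k\<bar>)"
      using pq(1) by (subst sum.remove[of _ p]) (auto simp: z_def intro: sum.cong)
    moreover have "(\<Sum>k<n. \<bar>y k\<bar>) = \<bar>y p\<bar> + (\<Sum>k\<in>{..<n} - {p}. \<bar>y k\<bar>)"
      using pq(1) by (subst sum.remove[of _ p]) auto
    moreover have "(\<Sum>k\<in>{..<n} - {p}. \<bar>y k\<bar>) \<ge> 0" by (rule sum_nonneg) auto
    ultimately have dec: "nat (\<Sum>k<n. \<bar>z k\<bar>) < nat (\<Sum>k<n. \<bar>y k\<bar>)"
      by linarith
    have "(\<Sum>k<n. z k * b k x) = 0" if "x \<in> P" for x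
    proof -
      have "(\<Sum>k<n. z k * b k x) = (\<Sum>k<n. y k * a k x
          - (if k = p then c * y q * a p x else 0) + (if k = q then c * y q * a p x else 0))"
        by (rule sum.cong) (use pq(3) in \<open>simp_all add: z_def b_def algebra_simps\<close>)
      also have "\<dots> = (\<Sum>k<n. y k * a k x)"
        using pq(1,2) by (simp add: sum.distrib sum_subtractf)
      finally show ?thesis using less.prems(1) that by simp
    qed
    moreover have "z q \<noteq> 0" using pq by (simp add: z_def)
    ultimately obtain b' i' where "row_equiv n b b'" "i' < n" "\<forall>x\<in>P. b' i' x = 0"
      using less.hyps[OF dec, of b q] pq(2) by blast
    then show ?thesis using row_equiv_trans b by blast
  qed
qed

text \<open>The zero row is moved to the end.\<close>

lemma row_relation_imp_zero_last_row:
  assumes "\<not> indep_rows {..<Suc n} a P"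
  shows "\<exists>b. row_equiv (Suc n) a b \<and> (\<forall>x\<in>P. b n x = 0)"
proof -
  from assms obtain y i where "\<forall>x\<in>P. (\<Sum>k<Suc n. y k * a k x) = 0" "i < Suc n" "y i \<noteq> 0"
    unfolding indep_rows_def by auto
  from row_relation_imp_zero_row[OF this]
  obtain b i where b: "row_equiv (Suc n) a b" "i < Suc n" "\<forall>x\<in>P. b i x = 0" by blast
  show ?thesis
  proof (cases "i = n")
    case True
    then show ?thesis using b by blast
  next
    case False
    \<comment> \<open>On \<open>P\<close>, the zero row \<open>i\<close> becomes a copy of row \<open>n\<close>, and subtracting the copy clears row \<open>n\<close>.\<close>
    define b1 where "b1 = b(i := (\<lambda>x. b i x + 1 * b n x))"
    define b2 where "b2 = b1(n := (\<lambda>x. b1 n x + (- 1) * b1 i x))"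
    have "row_equiv (Suc n) a b2"
      unfolding b1_def b2_def by (intro row_equiv.intros b(1)) (use b(2) False in auto)
    moreover have "\<forall>x\<in>P. b2 n x = 0" using b(3) False by (auto simp: b2_def b1_def)
    ultimately show ?thesis by blast
  qed
qed

text \<open>As long as the first rows are dependent on \<open>P\<close>, the last of them can be made zero on \<open>P\<close> and then be
  left alone.\<close>

lemma row_reduction:
  "\<exists>b s. row_equiv n a b \<and> s \<le> n \<and> indep_rows {..<s} b P \<and>
    (\<forall>i x. s \<le> i \<longrightarrow> i < n \<longrightarrow> x \<in> P \<longrightarrow> b i x = 0)"
proof (induction n arbitrary: a)
  case 0
  have "row_equiv 0 a a \<and> 0 \<le> (0::nat) \<and> indep_rows {..<0} a P"
    by (auto intro: row_equiv.row_refl simp: indep_rows_def)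
  then show ?case by blast
next
  case (Suc n)
  show ?case
  proof (cases "indep_rows {..<Suc n} a P")
    case True
    then show ?thesis by (intro exI[of _ a] exI[of _ "Suc n"]) (auto intro: row_equiv.row_refl)
  next
    case False
    then obtain b where b: "row_equiv (Suc n) a b" "\<forall>x\<in>P. b n x = 0"
      using row_relation_imp_zero_last_row by blast
    obtain b' s where b': "row_equiv n b b'" "s \<le> n" "indep_rows {..<s} b' P"
      "\<forall>i x. s \<le> i \<longrightarrow> i < n \<longrightarrow> x \<in> P \<longrightarrow> b' i x = 0"
      using Suc.IH by blast
    have "row_equiv (Suc n) a b'"
      using row_equiv_trans[OF row_equiv_mono[OF b'(1)] b(1)] by simp
    moreover have "\<forall>x\<in>P. b' n x = 0" using row_equiv_row_eq[OF b'(1)] b(2) by simp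
    ultimately show ?thesis
      using b' by (intro exI[of _ b'] exI[of _ s]) (auto simp: less_Suc_eq)
  qed
qed

section \<open>Block triangular matrices\<close>

lemma det_colmat_block_triangular:
  assumes "length xs = s" "length ys = n - s" "s \<le> n"
    and zero: "\<And>i x. s \<le> i \<Longrightarrow> i < n \<Longrightarrow> x \<in> set xs \<Longrightarrow> a i x = 0"
  shows "det (colmat n a (xs @ ys)) = det (colmat s a xs) * det (colmat (n - s) (\<lambda>i. a (i + s)) ys)"
proof -
  let ?B = "four_block_mat (colmat s a xs) (colmat s a ys) (0\<^sub>m (n - s) s)
    (colmat (n - s) (\<lambda>i. a (i + s)) ys)"
  have "colmat n a (xs @ ys) = ?B"
    using assms(1-3) by (intro eq_matI) (auto simp: colmat_def nth_append zero)
  also have "det ?B = det (colmat s a xs) * det (colmat (n - s) (\<lambda>i. a (i + s)) ys)"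
    by (rule det_four_block_mat_lower_left_zero) (use assms(1,2) in auto)
  finally show ?thesis .
qed

text \<open>A relation between the lower rows on \<open>E - P\<close> is one on all of \<open>E\<close>, since these rows vanish on \<open>P\<close>.\<close>

lemma indep_rows_contraction:
  assumes "indep_rows {..<n} a E" "s \<le> n"
    and zero: "\<And>i x. s \<le> i \<Longrightarrow> i < n \<Longrightarrow> x \<in> P \<Longrightarrow> a i x = 0"
  shows "indep_rows {..<n - s} (\<lambda>i. a (i + s)) (E - P)"
  unfolding indep_rows_def
proof (intro allI impI)
  fix w :: "nat \<Rightarrow> int" assume w: "\<forall>x\<in>E - P. (\<Sum>i<n - s. w i * a (i + s) x) = 0"
  define w' where "w' i = (if i < s then 0 else w (i - s))" for i
  have shift: "(\<Sum>i<n. w' i * a i x) = (\<Sum>i<n - s. w i * a (i + s) x)" for x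
  proof -
    have "(\<Sum>i<n. w' i * a i x) = (\<Sum>i\<in>{s..<n}. w (i - s) * a i x)"
      by (rule sum.mono_neutral_cong_right) (use assms(2) in \<open>auto simp: w'_def\<close>)
    also have "\<dots> = (\<Sum>i<n - s. w i * a (i + s) x)"
      by (rule sum.reindex_bij_witness[of _ "\<lambda>i. i + s" "\<lambda>i. i - s"]) (use assms(2) in auto)
    finally show ?thesis .
  qed
  have "(\<Sum>i<n. w' i * a i x) = 0" if "x \<in> E" for x
  proof (cases "x \<in> P")
    case True
    then show ?thesis by (intro sum.neutral) (auto simp: w'_def zero)
  next
    case False
    then show ?thesis using w that by (simp add: shift)
  qed
  from indep_rowsD[OF assms(1) this] have "w' (i + s) = 0" if "i < n - s" for i
    using that by simp
  then show "\<forall>i\<in>{..<n - s}. w i = 0" by (simp add: w'_def)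
qed

text \<open>The lower rows represent the contraction: \<open>xs\<close> will be a basis of the contracted set. Given a
  relation between the lower parts of the columns in \<open>X\<close>, the nonsingular block on \<open>xs\<close> can cancel
  whatever the upper parts sum up to, without any effect on the lower rows.\<close>

lemma indep_cols_contraction:
  assumes "length xs = s" "s \<le> n" "det (colmat s a xs) \<noteq> 0" "finite X" "X \<inter> set xs = {}"
    and zero: "\<And>i x. s \<le> i \<Longrightarrow> i < n \<Longrightarrow> x \<in> set xs \<Longrightarrow> a i x = 0"
  shows "indep_cols n a (X \<union> set xs) \<longleftrightarrow> indep_cols (n - s) (\<lambda>i. a (i + s)) X"
proof
  assume ind: "indep_cols n a (X \<union> set xs)"
  show "indep_cols (n - s) (\<lambda>i. a (i + s)) X"
    unfolding indep_cols_def
  proof (intro allI impI)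
    fix v :: "'a \<Rightarrow> real" assume v: "\<forall>i<n - s. (\<Sum>x\<in>X. v x * a (i + s) x) = 0"
    obtain u :: "'a \<Rightarrow> real" where u: "\<And>i. i < s \<Longrightarrow> (\<Sum>x\<in>set xs. u x * a i x) = - (\<Sum>x\<in>X. v x * a i x)"
      using nonzero_det_solve[OF assms(1,3), where t = "\<lambda>i. - (\<Sum>x\<in>X. v x * a i x)"] by blast
    define z where "z x = (if x \<in> X then v x else u x)" for x
    have split: "(\<Sum>x\<in>X \<union> set xs. z x * a i x)
        = (\<Sum>x\<in>X. v x * a i x) + (\<Sum>x\<in>set xs. u x * a i x)" for i
    proof -
      have "(\<Sum>x\<in>X \<union> set xs. z x * a i x) = (\<Sum>x\<in>X. z x * a i x) + (\<Sum>x\<in>set xs. z x * a i x)"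
        using assms(4,5) by (intro sum.union_disjoint) auto
      moreover have "(\<Sum>x\<in>X. z x * a i x) = (\<Sum>x\<in>X. v x * a i x)"
        by (rule sum.cong) (auto simp: z_def)
      moreover have "(\<Sum>x\<in>set xs. z x * a i x) = (\<Sum>x\<in>set xs. u x * a i x)"
        by (rule sum.cong) (use assms(5) in \<open>auto simp: z_def\<close>)
      ultimately show ?thesis by simp
    qed
    have "(\<Sum>x\<in>X \<union> set xs. z x * a i x) = 0" if "i < n" for i
    proof (cases "i < s")
      case True
      then show ?thesis by (simp add: split u)
    next
      case False
      then have "(\<Sum>x\<in>set xs. u x * a i x) = 0"
        using that by (intro sum.neutral) (auto simp: zero)
      moreover have "(\<Sum>x\<in>X. v x * a i x) = 0"
        using v[rule_format, of "i - s"] that False by simp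
      ultimately show ?thesis by (simp add: split)
    qed
    from indep_colsD[OF ind this] show "\<forall>x\<in>X. v x = 0" by (metis UnI1 z_def)
  qed
next
  assume ind: "indep_cols (n - s) (\<lambda>i. a (i + s)) X"
  show "indep_cols n a (X \<union> set xs)"
    unfolding indep_cols_def
  proof (intro allI impI)
    fix v :: "'a \<Rightarrow> real" assume v: "\<forall>i<n. (\<Sum>x\<in>X \<union> set xs. v x * a i x) = 0"
    have split: "(\<Sum>x\<in>X \<union> set xs. v x * a i x)
        = (\<Sum>x\<in>X. v x * a i x) + (\<Sum>x\<in>set xs. v x * a i x)" for i
      using assms(4,5) by (intro sum.union_disjoint) auto
    have "(\<Sum>x\<in>X. v x * a (i + s) x) = 0" if "i < n - s" for i
    proof -
      have "(\<Sum>x\<in>set xs. v x * a (i + s) x) = 0"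
        using that by (intro sum.neutral) (auto simp: zero)
      then show ?thesis using v[rule_format, of "i + s"] that by (simp add: split)
    qed
    from indep_colsD[OF ind this] have X: "v x = 0" if "x \<in> X" for x using that by blast
    have "(\<Sum>x\<in>set xs. v x * a i x) = 0" if "i < s" for i
      using v[rule_format, of i] that assms(2) by (simp add: split X)
    from indep_colsD[OF nonzero_det_indep_cols[OF assms(1,3)] this]
    show "\<forall>x\<in>X \<union> set xs. v x = 0" using X by blast
  qed
qed

text \<open>The columns in \<open>P\<close> have zeros from row \<open>s\<close> on, and the nonsingular block on \<open>xs\<close> generates everything in
  the first \<open>s\<close> rows.\<close>

lemma nonzero_det_maximal_indep_cols:
  assumes "length xs = s" "det (colmat s a xs) \<noteq> 0" "set xs \<subseteq> P"
    and zero: "\<And>i x. s \<le> i \<Longrightarrow> i < n \<Longrightarrow> x \<in> P \<Longrightarrow> a i x = 0"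
    and "finite K" "set xs \<subseteq> K" "K \<subseteq> P" "indep_cols n a K"
  shows "K = set xs"
proof (rule ccontr)
  assume "K \<noteq> set xs"
  with assms(6) obtain y where y: "y \<in> K" "y \<notin> set xs" by blast
  obtain u :: "'a \<Rightarrow> real" where u: "\<And>i. i < s \<Longrightarrow> (\<Sum>x\<in>set xs. u x * a i x) = - real_of_int (a i y)"
    using nonzero_det_solve[OF assms(1,2), where t = "\<lambda>i. - real_of_int (a i y)"] by blast
  define v where "v x = (if x = y then 1 else if x \<in> set xs then u x else 0)" for x
  have "(\<Sum>x\<in>K. v x * a i x) = 0" if "i < n" for i
  proof (cases "i < s")
    case True
    have "(\<Sum>x\<in>K. v x * a i x) = (\<Sum>x\<in>insert y (set xs). v x * a i x)"
      by (rule sum.mono_neutral_right) (use assms(5,6) y in \<open>auto simp: v_def\<close>)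
    also have "\<dots> = a i y + (\<Sum>x\<in>set xs. v x * a i x)"
      using y(2) by (simp add: v_def)
    also have "(\<Sum>x\<in>set xs. v x * a i x) = (\<Sum>x\<in>set xs. u x * a i x)"
      by (rule sum.cong) (use y(2) in \<open>auto simp: v_def\<close>)
    finally show ?thesis using u[OF True] by simp
  next
    case False
    then show ?thesis using assms(7) that by (intro sum.neutral) (auto simp: zero)
  qed
  from indep_colsD[OF assms(8) this y(1)] show False by (simp add: v_def)
qed


section \<open>Submatrices\<close>

lemma bij_betw_pick:
  assumes "finite J"
  shows "bij_betw (pick J) {..<card J} J"
proof -
  have "strict_mono_on {..<card J} (pick J)"
    by (rule strict_mono_onI) (simp add: pick_mono)
  then have inj: "inj_on (pick J) {..<card J}" by (rule strict_mono_on_imp_inj_on)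
  moreover have "pick J ` {..<card J} \<subseteq> J" by (auto intro: pick_in_set)
  ultimately show ?thesis
    using card_subset_eq[OF assms, of "pick J ` {..<card J}"]
    by (simp add: bij_betw_def card_image)
qed

lemma submatrix_colmat:
  assumes "J \<subseteq> {..<length xs}"
  shows "submatrix (colmat n a xs) I J = colmat (card {i. i < n \<and> i \<in> I}) (\<lambda>i. a (pick I i))
    (map (\<lambda>j. xs ! pick J j) [0..<card J])"
proof -
  have J: "{j. j < length xs \<and> j \<in> J} = J" using assms by auto
  have fin: "finite J" using assms finite_subset by blast
  have "pick J j < length xs" if "j < card J" for j
    using pick_in_set[of j J] that assms by blast
  moreover have "pick I i < n" if "i < card {i. i < n \<and> i \<in> I}" for i
    using pick_le[OF that] .
  ultimately show ?thesis
    by (intro eq_matI) (auto simp: submatrix_def colmat_def J)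
qed

lemma
  assumes "distinct xs" "J \<subseteq> {..<length xs}"
  shows distinct_selected_columns: "distinct (map (\<lambda>j. xs ! pick J j) [0..<card J])"
    and set_selected_columns: "set (map (\<lambda>j. xs ! pick J j) [0..<card J]) = (!) xs ` J"
proof -
  have bij: "bij_betw (pick J) {..<card J} J"
    using assms(2) finite_subset by (intro bij_betw_pick) blast
  have inj: "inj_on ((!) xs) J"
    by (rule inj_on_nth[OF assms(1)]) (use assms(2) in auto)
  have "inj_on (\<lambda>j. xs ! pick J j) {..<card J}"
    using comp_inj_on[of "pick J" "{..<card J}" "(!) xs"] bij inj
    by (simp add: bij_betw_def o_def)
  then show "distinct (map (\<lambda>j. xs ! pick J j) [0..<card J])"
    by (simp add: distinct_map atLeast0LessThan)
  have "pick J ` {..<card J} = J" using bij by (simp add: bij_betw_def)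
  then show "set (map (\<lambda>j. xs ! pick J j) [0..<card J]) = (!) xs ` J"
    by (auto simp: atLeast0LessThan image_image[symmetric])
qed

lemma real_rank_submatrix_colmat:
  assumes "distinct xs" "J \<subseteq> {..<length xs}"
  shows "real_rank (submatrix (colmat n a xs) UNIV J) =
    Max (card ` {K. K \<subseteq> (!) xs ` J \<and> indep_cols n a K})"
  using real_rank_colmat[OF distinct_selected_columns[OF assms], of n a]
  unfolding set_selected_columns[OF assms]
  by (simp add: submatrix_colmat[OF assms(2)] pick_UNIV)

lemma indep_rows_pick:
  assumes "indep_rows I a P" "finite I"
  shows "indep_rows {..<card I} (\<lambda>i. a (pick I i)) P"
  unfolding indep_rows_def
proof (intro allI impI)
  note bij = bij_betw_pick[OF assms(2)]
  fix w :: "nat \<Rightarrow> int" assume w: "\<forall>x\<in>P. (\<Sum>i<card I. w i * a (pick I i) x) = 0"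
  define w' where "w' = (\<lambda>i. w (the_inv_into {..<card I} (pick I) i))"
  have w': "w' (pick I i) = w i" if "i < card I" for i
    using that by (simp add: w'_def the_inv_into_f_f[OF bij_betw_imp_inj_on[OF bij]])
  have "(\<Sum>i\<in>I. w' i * a i x) = 0" if "x \<in> P" for x
  proof -
    have "(\<Sum>i\<in>I. w' i * a i x) = (\<Sum>i<card I. w' (pick I i) * a (pick I i) x)"
      by (rule sum.reindex_bij_betw[OF bij, symmetric])
    also have "\<dots> = (\<Sum>i<card I. w i * a (pick I i) x)" by (simp add: w')
    finally show ?thesis using w that by simp
  qed
  from indep_rowsD[OF assms(1) this] have "w' (pick I i) = 0" if "i < card I" for i
    using that by (simp add: pick_in_set)
  then show "\<forall>i\<in>{..<card I}. w i = 0" using w' by simp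
qed

text \<open>A matrix may have more rows than its rank. Restricting to a maximal independent set of rows does
  not change the independent columns: every other row is a rational combination of the selected ones.
  Its minors are minors of the given matrix, so modularity is inherited.\<close>

lemma full_row_rank_selection:
  "\<exists>I \<subseteq> {..<n}. indep_rows {..<card I} (\<lambda>i. a (pick I i)) E \<and>
    (\<forall>X \<subseteq> E. indep_cols (card I) (\<lambda>i. a (pick I i)) X \<longleftrightarrow> indep_cols n a X)"
proof -
  let ?S = "{I. I \<subseteq> {..<n} \<and> indep_rows I a E}"
  have "finite ?S" "{} \<in> ?S" by (auto simp: indep_rows_def)
  then obtain I where I: "I \<subseteq> {..<n}" "indep_rows I a E" and max: "\<forall>J\<in>?S. I \<subseteq> J \<longrightarrow> I = J"
    using finite_has_maximal[of ?S] by blast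
  have fin: "finite I" using I(1) finite_subset by blast
  have dep: "(\<Sum>x\<in>X. v x * a k x) = 0"
    if v: "\<And>i. i \<in> I \<Longrightarrow> (\<Sum>x\<in>X. v x * a i x) = 0" and k: "k < n" and X: "X \<subseteq> E"
    for v :: "'a \<Rightarrow> real" and X k
  proof (cases "k \<in> I")
    case True
    then show ?thesis by (rule v)
  next
    case False
    then have "\<not> indep_rows (insert k I) a E" using max I(1) k by blast
    then obtain y i where y: "\<forall>x\<in>E. (\<Sum>i\<in>insert k I. y i * a i x) = 0"
      and i: "i \<in> insert k I" "y i \<noteq> 0"
      unfolding indep_rows_def by blast
    have y': "y k * a k x = - (\<Sum>i\<in>I. y i * a i x)" if "x \<in> E" for x
      using y[rule_format, OF that] False fin by simp
    \<comment> \<open>Otherwise \<open>y\<close> would be a relation between the selected rows.\<close>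
    have "y k \<noteq> 0"
    proof
      assume "y k = 0"
      then have "(\<Sum>i\<in>I. y i * a i x) = 0" if "x \<in> E" for x using y'[OF that] by simp
      from indep_rowsD[OF I(2) this] i \<open>y k = 0\<close> show False by blast
    qed
    have "real_of_int (y k) * (\<Sum>x\<in>X. v x * a k x) = (\<Sum>x\<in>X. v x * real_of_int (y k * a k x))"
      by (simp add: sum_distrib_left algebra_simps)
    also have "\<dots> = (\<Sum>x\<in>X. v x * real_of_int (- (\<Sum>i\<in>I. y i * a i x)))"
      by (rule sum.cong[OF refl]) (simp only: y'[OF subsetD[OF X]])
    also have "\<dots> = - (\<Sum>x\<in>X. \<Sum>i\<in>I. y i * (v x * a i x))"
      by (simp add: sum_distrib_left sum_negf algebra_simps)
    also have "\<dots> = - (\<Sum>i\<in>I. y i * (\<Sum>x\<in>X. v x * a i x))"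
      by (subst sum.swap) (simp add: sum_distrib_left)
    also have "\<dots> = 0" by (simp add: v)
    finally show ?thesis using \<open>y k \<noteq> 0\<close> by simp
  qed
  have pick: "pick I ` {..<card I} = I" using bij_betw_pick[OF fin] by (simp add: bij_betw_def)
  have "(\<forall>i<card I. (\<Sum>x\<in>X. v x * a (pick I i) x) = 0) \<longleftrightarrow> (\<forall>i<n. (\<Sum>x\<in>X. v x * a i x) = 0)"
    if X: "X \<subseteq> E" for X and v :: "'a \<Rightarrow> real"
  proof
    assume *: "\<forall>i<card I. (\<Sum>x\<in>X. v x * a (pick I i) x) = 0"
    have "(\<Sum>x\<in>X. v x * a i x) = 0" if "i \<in> I" for i
    proof -
      from that have "i \<in> pick I ` {..<card I}" by (simp only: pick)
      then show ?thesis using * by auto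
    qed
    from dep[OF this _ X] show "\<forall>i<n. (\<Sum>x\<in>X. v x * a i x) = 0" by blast
  next
    assume "\<forall>i<n. (\<Sum>x\<in>X. v x * a i x) = 0"
    then show "\<forall>i<card I. (\<Sum>x\<in>X. v x * a (pick I i) x) = 0"
      using pick I(1) by blast
  qed
  then have "\<forall>X \<subseteq> E. indep_cols (card I) (\<lambda>i. a (pick I i)) X \<longleftrightarrow> indep_cols n a X"
    unfolding indep_cols_def by simp
  with I indep_rows_pick[OF I(2) fin] show ?thesis by blast
qed

section \<open>Iterated contraction\<close>

context matroid
begin

lemma contraction_empty: "contraction M {} = M"
proof -
  have "basis_of M {} B \<longleftrightarrow> B = {}" for B
    using indep_empty by (auto simp: basis_of_def)
  then have "(\<lambda>X. X \<subseteq> ground M - {} \<and> (\<exists>B. basis_of M {} B \<and> indep M (X \<union> B))) = indep M"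
    using indep_subset_ground by auto
  then show ?thesis by (simp add: contraction_def)
qed

text \<open>A basis of \<open>C\<close> and a basis of \<open>D\<close> in \<open>M / C\<close> together form a basis of \<open>C \<union> D\<close>.\<close>

lemma contraction_contraction: "contraction (contraction M C) D = contraction M (C \<union> D)"
proof -
  interpret C: matroid "contraction M C" by (rule matroid_contraction)
  obtain B where B: "basis_of M C B" using basis_of_exists by blast
  obtain B' where B': "basis_of (contraction M C) D B'" using C.basis_of_exists by blast
  have ind: "indep (contraction M C) X \<longleftrightarrow> X \<subseteq> ground M - C \<and> indep M (X \<union> B)" for X
    using indep_contraction_any[OF _ B, of X] by (auto simp: contraction_def)
  have B'_props: "B' \<subseteq> D" "B' \<subseteq> ground M - C" "indep M (B' \<union> B)"
    using B' ind unfolding basis_of_def by auto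
  have union: "basis_of M (C \<union> D) (B \<union> B')"
    unfolding basis_of_def
  proof (intro conjI allI impI)
    show "B \<union> B' \<subseteq> C \<union> D" using B B' unfolding basis_of_def by blast
    show "indep M (B \<union> B')" using B'_props by (simp add: Un_commute)
    fix K assume K: "B \<union> B' \<subseteq> K \<and> K \<subseteq> C \<union> D \<and> indep M K"
    have "indep M (K \<inter> C)" using K indep_subset by blast
    moreover have "B \<subseteq> K \<inter> C" using K B unfolding basis_of_def by blast
    ultimately have KC: "K \<inter> C = B" using B unfolding basis_of_def by blast
    have "indep M ((K - C) \<union> B)" by (rule indep_subset[of K]) (use K KC in auto)
    then have "indep (contraction M C) (K - C)"
      using K indep_subset_ground ind by blast
    moreover have "B' \<subseteq> K - C" "K - C \<subseteq> D" using K B'_props by blast+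
    ultimately have "K - C = B'" using B' unfolding basis_of_def by blast
    with KC show "K = B \<union> B'" by blast
  qed
  have "indep (contraction (contraction M C) D) X \<longleftrightarrow> indep (contraction M (C \<union> D)) X" for X
  proof (cases "X \<subseteq> ground M - (C \<union> D)")
    case True
    then have "X \<subseteq> ground (contraction M C) - D" by (auto simp: contraction_def)
    then have "indep (contraction (contraction M C) D) X \<longleftrightarrow> indep (contraction M C) (X \<union> B')"
      by (rule C.indep_contraction_any[OF _ B'])
    also have "\<dots> \<longleftrightarrow> indep M (X \<union> (B \<union> B'))"
      using True B'_props(2) ind by (auto simp: ac_simps)
    also have "\<dots> \<longleftrightarrow> indep (contraction M (C \<union> D)) X"
      by (rule indep_contraction_any[OF True union, symmetric])
    finally show ?thesis .
  qed (auto simp: contraction_def)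
  then have "indep (contraction (contraction M C) D) = indep (contraction M (C \<union> D))" by blast
  then show ?thesis by (simp add: contraction_def Diff_Diff_Int set_diff_eq)
qed

end

section \<open>Representations of matroids\<close>

definition represented_by :: "nat \<Rightarrow> (nat \<Rightarrow> 'b \<Rightarrow> int) \<Rightarrow> 'b matroid \<Rightarrow> bool" where
  "represented_by n a M \<longleftrightarrow> (\<forall>X \<subseteq> ground M. indep M X \<longleftrightarrow> indep_cols n a X)"

text \<open>A set is independent if and only if its rank is its size. The predicate \<open>Q\<close> will be independence
  in a matroid as well as independence of columns.\<close>

lemma Max_card_subsets_eq_card_iff:
  assumes "finite X" "Q {}"
  shows "Max (card ` {K. K \<subseteq> X \<and> Q K}) = card X \<longleftrightarrow> Q X"
proof
  have fin: "finite (card ` {K. K \<subseteq> X \<and> Q K})" using assms(1) by simp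
  assume "Max (card ` {K. K \<subseteq> X \<and> Q K}) = card X"
  moreover have "Max (card ` {K. K \<subseteq> X \<and> Q K}) \<in> card ` {K. K \<subseteq> X \<and> Q K}"
    by (rule Max_in[OF fin]) (use assms(2) in blast)
  ultimately obtain K where "K \<subseteq> X" "Q K" "card K = card X" by auto
  then show "Q X" using card_subset_eq[OF assms(1)] by metis
next
  assume "Q X"
  then show "Max (card ` {K. K \<subseteq> X \<and> Q K}) = card X"
    using assms(1) by (intro Max_eqI) (auto intro: card_mono)
qed

text \<open>Representations by rank functions and by independent sets agree. The bijection between elements and
  column numbers is turned into a list \<open>es\<close> of the elements in the order of their columns.\<close>

lemma represents_iff_represented_by:
  assumes "matroid M"
  shows "represents A M \<longleftrightarrow> (\<exists>a es. distinct es \<and> set es = ground M \<and>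
    A = colmat (dim_row A) a es \<and> represented_by (dim_row A) a M)"
proof
  interpret matroid M by (rule assms)
  assume "represents A M"
  then obtain c where c: "bij_betw c (ground M) {..<dim_col A}"
    and rank: "\<And>X. X \<subseteq> ground M \<Longrightarrow> matroid_rank M X = real_rank (submatrix A UNIV (c ` X))"
    unfolding represents_def by blast
  define d where "d = the_inv_into (ground M) c"
  have d: "bij_betw d {..<dim_col A} (ground M)"
    unfolding d_def by (rule bij_betw_the_inv_into[OF c])
  have cd: "c (d j) = j" if "j < dim_col A" for j
    using f_the_inv_into_f_bij_betw[OF c] that by (simp add: d_def)
  have dc: "d (c x) = x" if "x \<in> ground M" for x
    using the_inv_into_f_f[OF bij_betw_imp_inj_on[OF c] that] by (simp add: d_def)
  define es where "es = map d [0..<dim_col A]"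
  define a where "a i x = A $$ (i, c x)" for i x
  have es: "distinct es" "set es = ground M"
    using d by (auto simp: es_def distinct_map bij_betw_def atLeast0LessThan)
  have A: "A = colmat (dim_row A) a es"
    by (intro eq_matI) (auto simp: colmat_def es_def a_def cd)
  have "indep M X \<longleftrightarrow> indep_cols (dim_row A) a X" if X: "X \<subseteq> ground M" for X
  proof -
    have finX: "finite X" using X finite_ground finite_subset by blast
    have cX: "c ` X \<subseteq> {..<length es}"
      using c X by (auto simp: es_def bij_betw_def)
    have "(!) es ` c ` X = d ` c ` X"
      using cX by (intro image_cong) (auto simp: es_def)
    also have "\<dots> = X" using X dc by (force simp: image_image)
    finally have rank_X: "matroid_rank M X = Max (card ` {K. K \<subseteq> X \<and> indep_cols (dim_row A) a K})"
      using rank[OF X] real_rank_submatrix_colmat[OF es(1) cX, of "dim_row A" a] A by simp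
    have "indep M X \<longleftrightarrow> matroid_rank M X = card X"
      unfolding matroid_rank_def
      by (rule Max_card_subsets_eq_card_iff[of X "indep M", OF finX indep_empty, symmetric])
    also have "\<dots> \<longleftrightarrow> indep_cols (dim_row A) a X"
      unfolding rank_X
      by (rule Max_card_subsets_eq_card_iff[of X "indep_cols (dim_row A) a", OF finX])
        (simp add: indep_cols_def)
    finally show ?thesis .
  qed
  then show "\<exists>a es. distinct es \<and> set es = ground M \<and>
    A = colmat (dim_row A) a es \<and> represented_by (dim_row A) a M"
    unfolding represented_by_def using es A by blast
next
  assume "\<exists>a es. distinct es \<and> set es = ground M \<and>
    A = colmat (dim_row A) a es \<and> represented_by (dim_row A) a M"
  then obtain a es where es: "distinct es" "set es = ground M"
    and A: "A = colmat (dim_row A) a es" and rep: "represented_by (dim_row A) a M" by blast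
  have col: "dim_col A = length es" by (subst A) simp
  have bij: "bij_betw ((!) es) {..<length es} (ground M)"
    by (rule bij_betw_nth) (use es in auto)
  define c where "c = the_inv_into {..<length es} ((!) es)"
  have c: "bij_betw c (ground M) {..<length es}"
    unfolding c_def by (rule bij_betw_the_inv_into[OF bij])
  have "es ! c x = x" if "x \<in> ground M" for x
    using f_the_inv_into_f_bij_betw[OF bij] that by (simp add: c_def)
  then have nth_c: "(!) es ` c ` X = X" if "X \<subseteq> ground M" for X
    using that by (force simp: image_image)
  have "matroid_rank M X = real_rank (submatrix A UNIV (c ` X))" if X: "X \<subseteq> ground M" for X
  proof -
    have "c ` X \<subseteq> {..<length es}" using c X by (auto simp: bij_betw_def)
    from real_rank_submatrix_colmat[OF es(1) this, of "dim_row A" a]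
    have "real_rank (submatrix A UNIV (c ` X)) =
        Max (card ` {K. K \<subseteq> X \<and> indep_cols (dim_row A) a K})"
      unfolding A[symmetric] nth_c[OF X] .
    also have "{K. K \<subseteq> X \<and> indep_cols (dim_row A) a K} = {K. K \<subseteq> X \<and> indep M K}"
      using rep X unfolding represented_by_def by blast
    finally show ?thesis by (simp add: matroid_rank_def)
  qed
  with c show "represents A M" unfolding represents_def col by blast
qed

lemma basis_of_nonzero_det:
  assumes "matroid M" "represented_by n a M" "P \<subseteq> ground M" "s \<le> n"
    and zero: "\<And>i x. s \<le> i \<Longrightarrow> i < n \<Longrightarrow> x \<in> P \<Longrightarrow> a i x = 0"
    and xs: "set xs \<subseteq> P" "length xs = s" "det (colmat s a xs) \<noteq> 0"
  shows "basis_of M P (set xs)"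
proof -
  interpret matroid M by (rule assms(1))
  have "indep_cols n a (set xs)"
    using indep_cols_contraction[of xs s n a "{}"] xs assms(4) zero
    by (auto simp: indep_cols_def[of _ _ "{}"])
  then have "indep M (set xs)"
    using assms(2,3) xs(1) unfolding represented_by_def by blast
  moreover have "K = set xs" if K: "set xs \<subseteq> K" "K \<subseteq> P" "indep M K" for K
  proof (rule nonzero_det_maximal_indep_cols[OF xs(2,3,1) zero _ K(1,2)])
    show "finite K" using K(3) by (rule indep_finite)
    show "indep_cols n a K"
      using K assms(2,3) unfolding represented_by_def by blast
  qed auto
  ultimately show ?thesis unfolding basis_of_def using xs(1) by blast
qed

lemma matroid_rank_full_row_rank:
  assumes "matroid M" "represented_by n a M" "indep_rows {..<n} a (ground M)"
  shows "matroid_rank M (ground M) = n"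
proof -
  interpret matroid M by (rule assms(1))
  obtain xs where xs: "set xs \<subseteq> ground M" "length xs = n" "det (colmat n a xs) \<noteq> 0"
    using indep_rows_imp_nonzero_det[OF assms(3)] by blast
  have basis: "basis_of M (ground M) (set xs)"
    by (rule basis_of_nonzero_det[OF assms(1,2) _ _ _ xs]) auto
  have "card (set xs) = n"
    using distinct_card[OF nonzero_det_distinct[OF xs(2,3)]] xs(2) by simp
  moreover have "card I \<le> card (set xs)" if "I \<subseteq> ground M" "indep M I" for I
    using basis_of_card_le[OF basis that] .
  moreover have "finite {I. I \<subseteq> ground M \<and> indep M I}" using finite_ground by simp
  ultimately show ?thesis
    unfolding matroid_rank_def using basis
    by (intro Max_eqI) (auto simp: basis_of_def)
qed

text \<open>The first \<open>s\<close> rows of the columns in \<open>P\<close> form an integer matrix that represents \<open>M | P\<close> and has rank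
  \<open>s\<close>. A large minor of it of size \<open>s\<close> must use all its rows.\<close>

lemma non_modular_large_det:
  assumes "matroid M" "represented_by n a M" "P \<subseteq> ground M" "s \<le> n"
    and rows: "indep_rows {..<s} a P"
    and zero: "\<And>i x. s \<le> i \<Longrightarrow> i < n \<Longrightarrow> x \<in> P \<Longrightarrow> a i x = 0"
    and not_modular: "restriction M P \<notin> modular_matroids \<Delta>"
  shows "\<exists>xs. set xs \<subseteq> P \<and> length xs = s \<and> \<bar>det (colmat s a xs)\<bar> > int \<Delta>"
proof -
  interpret matroid M by (rule assms(1))
  let ?N = "restriction M P"
  have N: "matroid ?N" by (rule matroid_restriction)
  have ground: "ground ?N = P" using assms(3) by (auto simp: restriction_def)
  have rep: "represented_by s a ?N"
    unfolding represented_by_def ground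
  proof (intro allI impI)
    fix X assume X: "X \<subseteq> P"
    have "(\<Sum>x\<in>X. v x * a i x) = 0" if "s \<le> i" "i < n" for i and v :: "'a \<Rightarrow> real"
      by (rule sum.neutral) (use zero that X in auto)
    then have "(\<forall>i<n. (\<Sum>x\<in>X. v x * a i x) = 0) \<longleftrightarrow> (\<forall>i<s. (\<Sum>x\<in>X. v x * a i x) = 0)"
      for v :: "'a \<Rightarrow> real"
      using assms(4) by (meson less_le_trans not_le)
    then have "indep_cols n a X \<longleftrightarrow> indep_cols s a X" unfolding indep_cols_def by simp
    moreover have "indep M X \<longleftrightarrow> indep_cols n a X"
      using assms(2,3) X unfolding represented_by_def by blast
    ultimately show "indep ?N X \<longleftrightarrow> indep_cols s a X"
      using X by (simp add: restriction_def)
  qed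
  obtain es where es: "distinct es" "set es = P"
    using finite_distinct_list[OF finite_subset[OF assms(3) finite_ground]] by blast
  let ?D = "colmat s a es"
  have "represents ?D ?N"
    unfolding represents_iff_represented_by[OF N]
    by (intro exI[of _ a] exI[of _ es]) (simp add: es ground rep)
  then have "\<not> modular_matrix \<Delta> ?D"
    using not_modular N unfolding modular_matroids_def by blast
  moreover have "real_rank ?D = s"
  proof -
    have "real_rank ?D = Max (card ` {K. K \<subseteq> P \<and> indep_cols s a K})"
      using real_rank_colmat[OF es(1)] es(2) by simp
    also have "{K. K \<subseteq> P \<and> indep_cols s a K} = {K. K \<subseteq> ground ?N \<and> indep ?N K}"
      using rep unfolding represented_by_def ground by blast
    also have "Max (card ` \<dots>) = s"
      using matroid_rank_full_row_rank[OF N rep] rows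
      by (simp add: ground matroid_rank_def)
    finally show ?thesis .
  qed
  ultimately obtain I J where IJ: "I \<subseteq> {..<s}" "card I = s" "J \<subseteq> {..<length es}" "card J = s"
    and det: "\<bar>det (submatrix ?D I J)\<bar> > int \<Delta>"
    unfolding modular_matrix_def by auto
  have I: "I = {..<s}" using IJ(1,2) by (intro card_subset_eq) auto
  define ys where "ys = map (\<lambda>j. es ! pick J j) [0..<card J]"
  have "submatrix ?D I J = colmat s (\<lambda>i. a (pick I i)) ys"
    unfolding submatrix_colmat[OF IJ(3)] ys_def by (simp add: I)
  also have "\<dots> = colmat s a ys"
  proof (rule eq_matI)
    have "pick I i = i" if "i < s" for i
      using pick_reduce_set[of i s UNIV] that by (simp add: I pick_UNIV lessThan_def)
    then show "colmat s (\<lambda>i. a (pick I i)) ys $$ (i, j) = colmat s a ys $$ (i, j)"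
      if "i < dim_row (colmat s a ys)" "j < dim_col (colmat s a ys)" for i j
      using that by (simp add: colmat_def)
  qed auto
  finally have "\<bar>det (colmat s a ys)\<bar> > int \<Delta>" using det by simp
  moreover have "set ys \<subseteq> P"
    using set_selected_columns[OF es(1) IJ(3)] IJ(3) es(2) unfolding ys_def by auto
  moreover have "length ys = s" using IJ(4) by (simp add: ys_def)
  ultimately show ?thesis by blast
qed

text \<open>Since rows are selected in increasing order, only the order of the columns can differ between a
  minor in terms of a list of labels and one of the given matrix; this affects the sign alone.\<close>

lemma modular_matroid_full_row_rank:
  assumes "M \<in> modular_matroids \<Delta>"
  shows "\<exists>n a. represented_by n a M \<and> indep_rows {..<n} a (ground M) \<and>
    (\<forall>xs. set xs \<subseteq> ground M \<longrightarrow> length xs = n \<longrightarrow> \<bar>det (colmat n a xs)\<bar> \<le> int \<Delta>)"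
proof -
  from assms obtain A where M: "matroid M" and mod: "modular_matrix \<Delta> A" and "represents A M"
    unfolding modular_matroids_def by blast
  then obtain a es where es: "distinct es" "set es = ground M"
    and A: "A = colmat (dim_row A) a es" and rep: "represented_by (dim_row A) a M"
    using represents_iff_represented_by[OF M] by blast
  define n where "n = dim_row A"
  have A': "A = colmat n a es" using A unfolding n_def .
  obtain I where I: "I \<subseteq> {..<n}" and rows: "indep_rows {..<card I} (\<lambda>i. a (pick I i)) (ground M)"
    and cols: "\<And>X. X \<subseteq> ground M \<Longrightarrow> indep_cols (card I) (\<lambda>i. a (pick I i)) X \<longleftrightarrow> indep_cols n a X"
    using full_row_rank_selection[of n a "ground M"] by blast
  let ?b = "\<lambda>i. a (pick I i)"
  have rep_b: "represented_by (card I) ?b M"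
    using rep cols unfolding represented_by_def n_def by simp
  have rank: "real_rank A = card I"
  proof -
    have "real_rank A = Max (card ` {K. K \<subseteq> ground M \<and> indep_cols n a K})"
      unfolding A' es(2)[symmetric] by (rule real_rank_colmat[OF es(1)])
    also have "{K. K \<subseteq> ground M \<and> indep_cols n a K} = {K. K \<subseteq> ground M \<and> indep M K}"
      using rep unfolding represented_by_def n_def by blast
    also have "Max (card ` \<dots>) = card I"
      using matroid_rank_full_row_rank[OF M rep_b rows] by (simp add: matroid_rank_def)
    finally show ?thesis .
  qed
  have "\<bar>det (colmat (card I) ?b xs)\<bar> \<le> int \<Delta>"
    if xs: "set xs \<subseteq> ground M" "length xs = card I" for xs
  proof (cases "det (colmat (card I) ?b xs) = 0")
    case False
    note d = nonzero_det_distinct[OF xs(2) False]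
    define J where "J = {j. j < length es \<and> es ! j \<in> set xs}"
    have J: "J \<subseteq> {..<length es}" by (auto simp: J_def)
    have img: "(!) es ` J = set xs"
    proof
      show "set xs \<subseteq> (!) es ` J"
      proof
        fix x assume x: "x \<in> set xs"
        then obtain j where "j < length es" "es ! j = x"
          using xs(1) es(2) by (metis in_set_conv_nth subsetD)
        with x show "x \<in> (!) es ` J" by (auto simp: J_def)
      qed
    qed (auto simp: J_def)
    define ys where "ys = map (\<lambda>j. es ! pick J j) [0..<card J]"
    have ys: "distinct ys" "set ys = set xs"
      using distinct_selected_columns[OF es(1) J] set_selected_columns[OF es(1) J] img
      by (auto simp: ys_def)
    have "card J = card (set ys)" using distinct_card[OF ys(1)] by (simp add: ys_def)
    then have cardJ: "card J = card I" using ys(2) distinct_card[OF d] xs(2) by simp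
    have "{i. i < n \<and> i \<in> I} = I" using I by auto
    then have sub: "submatrix A I J = colmat (card I) ?b ys"
      unfolding A' submatrix_colmat[OF J] by (simp add: ys_def)
    have "\<bar>det (colmat (card I) ?b xs)\<bar> = \<bar>det (colmat (card I) ?b ys)\<bar>"
      by (rule abs_det_colmat_perm[OF d ys(1) ys(2)[symmetric] xs(2)])
    also have "\<dots> \<le> int \<Delta>"
    proof -
      have "dim_row A = n" "dim_col A = length es" by (simp_all add: A')
      then have "\<bar>det (submatrix A I J)\<bar> \<le> int \<Delta>"
        using mod I J cardJ rank unfolding modular_matrix_def by simp
      then show ?thesis unfolding sub .
    qed
    finally show ?thesis .
  qed simp
  with rep_b rows show ?thesis by blast
qed

section \<open>Large minors from stacks\<close>

text \<open>Induction on the height, contracting the first layer. For \<open>h = 0\<close> the claim is that a nonzero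
  integer has absolute value at least one.\<close>

lemma stack_large_det:
  assumes "matroid M" "represented_by n a M" "indep_rows {..<n} a (ground M)"
    and "\<And>i. i \<in> {1..h} \<Longrightarrow> P i \<subseteq> ground M"
    and "disjoint_family_on P {1..h}"
    and "\<And>i. i \<in> {1..h} \<Longrightarrow>
      restriction (contraction M (\<Union>j\<in>{1..<i}. P j)) (P i) \<notin> modular_matroids 1"
  shows "\<exists>xs. set xs \<subseteq> ground M \<and> length xs = n \<and> \<bar>det (colmat n a xs)\<bar> \<ge> 2 ^ h"
  using assms
proof (induction h arbitrary: M n a P)
  case 0
  obtain xs where "set xs \<subseteq> ground M" "length xs = n" "det (colmat n a xs) \<noteq> 0"
    using indep_rows_imp_nonzero_det[OF "0.prems"(3)] by blast
  then show ?case by (intro exI[of _ xs]) auto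
next
  case (Suc h)
  interpret matroid M by (rule Suc.prems(1))
  let ?P = "P 1"
  have P: "?P \<subseteq> ground M" using Suc.prems(4)[of 1] by simp
  obtain b s where ab: "row_equiv n a b" and s: "s \<le> n" and rows: "indep_rows {..<s} b ?P"
    and "\<forall>i x. s \<le> i \<longrightarrow> i < n \<longrightarrow> x \<in> ?P \<longrightarrow> b i x = 0"
    using row_reduction by blast
  then have zero: "b i x = 0" if "s \<le> i" "i < n" "x \<in> ?P" for i x using that by blast
  have rep: "represented_by n b M"
    using Suc.prems(2) row_equiv_indep_cols[OF ab] unfolding represented_by_def by simp
  have "restriction M ?P \<notin> modular_matroids 1"
    using Suc.prems(6)[of 1] by (simp add: contraction_empty)
  from non_modular_large_det[OF Suc.prems(1) rep P s rows zero this]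
  obtain xs where xs: "set xs \<subseteq> ?P" "length xs = s" "\<bar>det (colmat s b xs)\<bar> > 1"
    by auto
  then have xs_det: "det (colmat s b xs) \<noteq> 0" by auto
  have basis: "basis_of M ?P (set xs)"
    by (rule basis_of_nonzero_det[OF Suc.prems(1) rep P s zero xs(1,2) xs_det])
  define M' where "M' = contraction M ?P"
  \<comment> \<open>The lower right block.\<close>
  define c where "c = (\<lambda>i. b (i + s))"
  have M': "matroid M'" "ground M' = ground M - ?P"
    by (simp_all add: M'_def matroid_contraction) (simp add: contraction_def)
  have rep': "represented_by (n - s) c M'"
    unfolding represented_by_def
  proof (intro allI impI)
    fix X assume "X \<subseteq> ground M'"
    then have X: "X \<subseteq> ground M - ?P" using M'(2) by simp
    have "indep M' X \<longleftrightarrow> indep M (X \<union> set xs)"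
      unfolding M'_def by (rule indep_contraction_any[OF X basis])
    also have "\<dots> \<longleftrightarrow> indep_cols n b (X \<union> set xs)"
      using rep X xs(1) P unfolding represented_by_def by blast
    also have "\<dots> \<longleftrightarrow> indep_cols (n - s) c X"
      unfolding c_def
    proof (rule indep_cols_contraction[OF xs(2) s xs_det])
      show "finite X" using X finite_ground finite_subset by blast
      show "X \<inter> set xs = {}" using X xs(1) by blast
      show "b i x = 0" if "s \<le> i" "i < n" "x \<in> set xs" for i x using zero that xs(1) by blast
    qed
    finally show "indep M' X \<longleftrightarrow> indep_cols (n - s) c X" .
  qed
  have rows': "indep_rows {..<n - s} c (ground M')"
    unfolding c_def M'(2)
    by (rule indep_rows_contraction[OF row_equiv_indep_rows[OF ab Suc.prems(3)] s zero])
  have layer: "restriction (contraction M' (\<Union>j\<in>{1..<i}. P (Suc j))) (P (Suc i)) \<notin> modular_matroids 1"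
    if "i \<in> {1..h}" for i
  proof -
    have "{1..<Suc i} = insert 1 (Suc ` {1..<i})"
      using that by (auto simp: image_Suc_atLeastLessThan)
    then have "?P \<union> (\<Union>j\<in>{1..<i}. P (Suc j)) = (\<Union>j\<in>{1..<Suc i}. P j)"
      by (simp only: UN_insert image_image)
    then have "contraction M' (\<Union>j\<in>{1..<i}. P (Suc j)) = contraction M (\<Union>j\<in>{1..<Suc i}. P j)"
      unfolding M'_def contraction_contraction by simp
    then show ?thesis using Suc.prems(6)[of "Suc i"] that by simp
  qed
  have "\<exists>ys. set ys \<subseteq> ground M' \<and> length ys = n - s \<and> \<bar>det (colmat (n - s) c ys)\<bar> \<ge> 2 ^ h"
  proof (rule Suc.IH[OF M'(1) rep' rows' _ _ layer])
    show "P (Suc i) \<subseteq> ground M'" if "i \<in> {1..h}" for i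
    proof -
      have "P (Suc i) \<inter> ?P = {}"
        by (rule disjoint_family_onD[OF Suc.prems(5)]) (use that in auto)
      moreover have "P (Suc i) \<subseteq> ground M" by (rule Suc.prems(4)) (use that in auto)
      ultimately show ?thesis unfolding M'(2) by blast
    qed
    show "disjoint_family_on (\<lambda>i. P (Suc i)) {1..h}"
      using Suc.prems(5) unfolding disjoint_family_on_def by auto
  qed auto
  then obtain ys where ys: "set ys \<subseteq> ground M'" "length ys = n - s"
    "\<bar>det (colmat (n - s) c ys)\<bar> \<ge> 2 ^ h" by blast
  have len: "length (xs @ ys) = n" using xs(2) ys(2) s by simp
  have "det (colmat n a (xs @ ys)) = det (colmat n b (xs @ ys))"
    by (rule row_equiv_det[OF ab len, symmetric])
  also have "\<dots> = det (colmat s b xs) * det (colmat (n - s) c ys)"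
    unfolding c_def by (rule det_colmat_block_triangular[OF xs(2) ys(2) s]) (use zero xs(1) in blast)
  finally have "\<bar>det (colmat n a (xs @ ys))\<bar> = \<bar>det (colmat s b xs)\<bar> * \<bar>det (colmat (n - s) c ys)\<bar>"
    by (simp add: abs_mult)
  also have "\<dots> \<ge> 2 * 2 ^ h"
    by (rule mult_mono) (use xs(3) ys(3) in auto)
  finally show ?case
    using xs(1) ys(1) P len M'(2) by (intro exI[of _ "xs @ ys"]) auto
qed

theorem proposition2p2:
  fixes \<Delta> m :: nat
  assumes "\<Delta> \<ge> 1" and "m \<ge> 2"
  shows "\<not> (\<exists>M :: 'a matroid. M \<in> modular_matroids \<Delta> \<and>
           is_stack (modular_matroids 1) m (nat \<lfloor>log 2 (real \<Delta>)\<rfloor> + 1) M)"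
proof (intro notI, elim exE conjE)
  fix M :: "'a matroid"
  let ?h = "nat \<lfloor>log 2 (real \<Delta>)\<rfloor> + 1"
  assume "M \<in> modular_matroids \<Delta>" and stack: "is_stack (modular_matroids 1) m ?h M"
  then obtain n a where a: "represented_by n a M" "indep_rows {..<n} a (ground M)"
    and le: "\<And>xs. set xs \<subseteq> ground M \<Longrightarrow> length xs = n \<Longrightarrow> \<bar>det (colmat n a xs)\<bar> \<le> int \<Delta>"
    using modular_matroid_full_row_rank by blast
  from stack obtain P where "matroid M" and P: "\<And>i. i \<in> {1..?h} \<Longrightarrow> P i \<subseteq> ground M"
    "disjoint_family_on P {1..?h}"
    "\<And>i. i \<in> {1..?h} \<Longrightarrow>
      restriction (contraction M (\<Union>j\<in>{1..<i}. P j)) (P i) \<notin> modular_matroids 1"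
    unfolding is_stack_def Let_def by blast
  from stack_large_det[OF \<open>matroid M\<close> a P]
  obtain xs where "set xs \<subseteq> ground M" "length xs = n" "\<bar>det (colmat n a xs)\<bar> \<ge> 2 ^ ?h"
    by blast
  with le have "(2::int) ^ ?h \<le> int \<Delta>" by force
  then have "real_of_int (2 ^ ?h) \<le> real_of_int (int \<Delta>)" by (rule of_int_le_iff[THEN iffD2])
  moreover have "2 powr real ?h = 2 ^ ?h" by (rule powr_realpow) simp
  ultimately have "2 powr real ?h \<le> real \<Delta>" by simp
  then have "real ?h \<le> log 2 (real \<Delta>)" using assms(1) by (subst le_log_iff) auto
  moreover have "log 2 (real \<Delta>) < real ?h" by linarith
  ultimately show False by linarith
qed

end
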